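(* Let $M$ be a complex matrix of order $n$, partitioned as a $k\times k$ block matrix with square diagonal blocks, and let $M=M_D+M_{\mathrm{off}}$ be its decomposition into the block diagonal part $M_D$ and the block off-diagonal part $M_{\mathrm{off}}$. If $\det(M)$ is real, $M_D$ is non-singular with $\det(M_D)$ real, and all eigenvalues $\lambda_j(M_D^{-1}M_{\mathrm{off}})$ are real with $\lambda_j(M_D^{-1}M_{\mathrm{off}})>-1$, then $$0< \frac{\det(M_D)-\det(M)}{\det(M_D)}\leq 1-e^{-\frac{n\rho^2}{1+\lambda_{\min}}},$$ where $\rho\equiv\rho(M_D^{-1}M_{\mathrm{off}})$ and $\lambda_{\min}\equiv\min_{1\leq j\leq n}\lambda_j(M_D^{-1}M_{\mathrm{off}})$.
   Context: $\rho(A)=\max_j|\lambda_j(A)|$ is the spectral radius of a square matrix $A$ with eigenvalues $\lambda_j(A)$. Given a partition of $M$ as a $k\times k$ block matrix $(M_{ij})_{1\le i,j\le k}$ whose diagonal blocks $M_{jj}$ are square (not necessarily of the same dimension), $M_D$ is the block diagonal matrix with diagonal blocks $M_{11},\dots,M_{kk}$ and zero off-diagonal blocks, and $M_{\mathrm{off}}=M-M_D$ (so $M_{\mathrm{off}}$ has zero diagonal blocks).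
   Formalization: The strict lower bound is proved when ρ ≠ 0; in general only 0 ≤ is claimed, because for ρ = 0 (for example M = I) all eigenvalues vanish, det(M) = det(M_D), and the quotient equals 0. *)

theory Defs
  imports "Jordan_Normal_Form.Spectral_Radius" "Jordan_Normal_Form.Gauss_Jordan_Elimination"
begin

text \<open>A partition into blocks is given by the list \<open>ns\<close> of the orders of the square diagonal
  blocks, so \<open>k = length ns\<close> and \<open>n = sum_list ns\<close>. Block indices start at \<open>0\<close>.\<close>

definition block :: "nat list \<Rightarrow> 'a mat \<Rightarrow> nat \<Rightarrow> nat \<Rightarrow> 'a mat" where
  "block ns A i j = mat (ns ! i) (ns ! j)
     (\<lambda>(r, c). A $$ (sum_list (take i ns) + r, sum_list (take j ns) + c))"

definition block_diag_part :: "nat list \<Rightarrow> 'a::zero mat \<Rightarrow> 'a mat" where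
  "block_diag_part ns A = diag_block_mat (map (\<lambda>j. block ns A j j) [0..<length ns])"

definition block_off_part :: "nat list \<Rightarrow> 'a::ring mat \<Rightarrow> 'a mat" where
  "block_off_part ns A = A - block_diag_part ns A"

text \<open>The library's \<open>mat_inverse\<close> is option-valued; the value of \<open>inv_mat A\<close> is meaningful only
  for invertible square \<open>A\<close>.\<close>

definition inv_mat :: "'a::field mat \<Rightarrow> 'a mat" where
  "inv_mat A = the (mat_inverse A)"

text \<open>Smallest real part of an eigenvalue; this is the smallest eigenvalue when all of them are
  real.\<close>

definition min_eigenvalue :: "complex mat \<Rightarrow> real" where
  "min_eigenvalue A = Min (Re ` spectrum A)"

end

theory Submission
  imports Defs
begin

text \<open>
  Let \<open>\<lambda>\<^sub>1, \<dots>, \<lambda>\<^sub>n\<close> be the eigenvalues of \<open>P = M\<^sub>D\<^sup>-\<^sup>1 M\<^sub>o\<^sub>f\<^sub>f\<close>. Since \<open>M = M\<^sub>D (1 + P)\<close>, the quotient in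
  question is \<open>1 - \<Prod>(1 + \<lambda>\<^sub>j)\<close>. The inverse of a block diagonal matrix is block diagonal, so \<open>P\<close> has
  zero diagonal and \<open>\<Sum>\<lambda>\<^sub>j = 0\<close>. Multiplying the bounds \<open>exp (x / (1 + x)) \<le> 1 + x \<le> exp x\<close> over
  \<open>x = \<lambda>\<^sub>j\<close>, where \<open>x / (1 + x) = x - x\<^sup>2 / (1 + x)\<close>, gives both inequalities.
\<close>

section \<open>Exponential bounds for \<open>1 + x\<close> and for products with zero exponent
  sum\<close>

lemma add_one_less_exp:
  fixes x :: real
  assumes "x \<noteq> 0" "x > - 1"
  shows "1 + x < exp x"
proof -
  have "1 + x \<noteq> exp x"
  proof
    assume "1 + x = exp x"
    then have "ln (1 + x) = (1 + x) - 1" by simp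
    then have "1 + x = 1" using ln_eq_minus_one[of "1 + x"] assms(2) by simp
    with assms(1) show False by simp
  qed
  with exp_ge_add_one_self[of x] show ?thesis by linarith
qed

text \<open>This is the reciprocal of \<open>1 + t \<le> exp t\<close> at
  \<open>t = - (x / (1 + x))\<close>, where \<open>1 + t = 1 / (1 + x)\<close>. The exponent is
  split into \<open>x\<close> and a quadratic remainder so that the linear parts cancel once factors
  with zero sum are multiplied.\<close>

lemma exp_le_add_one:
  fixes x :: real
  assumes "x > - 1"
  shows "exp (x - x\<^sup>2 / (1 + x)) \<le> 1 + x"
proof -
  have eq: "x - x\<^sup>2 / (1 + x) = x / (1 + x)"
    using assms by (simp add: field_simps power2_eq_square)
  have "1 / (1 + x) = 1 + - (x / (1 + x))" using assms by (simp add: field_simps)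
  also have "\<dots> \<le> exp (- (x / (1 + x)))" by (rule exp_ge_add_one_self)
  finally have "1 / (1 + x) \<le> 1 / exp (x / (1 + x))" by (simp add: exp_minus field_simps)
  then have "exp (x / (1 + x)) \<le> 1 + x" using assms by (simp add: field_simps)
  then show ?thesis unfolding eq .
qed

lemma
  fixes x :: "'a \<Rightarrow> real"
  assumes fin: "finite I" and sum: "(\<Sum>i\<in>I. x i) = 0" and gt: "\<And>i. i \<in> I \<Longrightarrow> x i > - 1"
  shows prod_add_one_le: "(\<Prod>i\<in>I. 1 + x i) \<le> 1"
    and prod_add_one_less: "j \<in> I \<Longrightarrow> x j \<noteq> 0 \<Longrightarrow> (\<Prod>i\<in>I. 1 + x i) < 1"
    and prod_add_one_ge:
      "(\<And>i. i \<in> I \<Longrightarrow> \<bar>x i\<bar> \<le> r) \<Longrightarrow> (\<And>i. i \<in> I \<Longrightarrow> m \<le> x i) \<Longrightarrow> m > - 1 \<Longrightarrow>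
        exp (- (real (card I) * r\<^sup>2 / (1 + m))) \<le> (\<Prod>i\<in>I. 1 + x i)"
proof -
  have exp1: "(\<Prod>i\<in>I. exp (x i)) = 1" using sum by (simp add: exp_sum[OF fin, symmetric])
  have le: "0 \<le> 1 + x i \<and> 1 + x i \<le> exp (x i)" if "i \<in> I" for i
    using gt[OF that] exp_ge_add_one_self[of "x i"] by linarith
  show "(\<Prod>i\<in>I. 1 + x i) \<le> 1" using prod_mono[of I "\<lambda>i. 1 + x i" "\<lambda>i. exp (x i)"] le exp1 by simp
  show "(\<Prod>i\<in>I. 1 + x i) < 1" if j: "j \<in> I" "x j \<noteq> 0"
  proof -
    \<comment> \<open>One strict factor suffices: the others are bounded weakly by exponentials,
      whose product is positive and so preserves strictness.\<close>
    have "(\<Prod>i\<in>I. 1 + x i) = (1 + x j) * (\<Prod>i\<in>I - {j}. 1 + x i)"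
      by (rule prod.remove[OF fin j(1)])
    also have "\<dots> \<le> (1 + x j) * (\<Prod>i\<in>I - {j}. exp (x i))"
      using le j(1) by (intro mult_left_mono prod_mono) auto
    also have "\<dots> < exp (x j) * (\<Prod>i\<in>I - {j}. exp (x i))"
      using add_one_less_exp[OF j(2) gt[OF j(1)]] by (intro mult_strict_right_mono prod_pos) auto
    also have "\<dots> = 1" unfolding exp1[symmetric] by (rule prod.remove[OF fin j(1), symmetric])
    finally show ?thesis .
  qed
  show "exp (- (real (card I) * r\<^sup>2 / (1 + m))) \<le> (\<Prod>i\<in>I. 1 + x i)"
    if r: "\<And>i. i \<in> I \<Longrightarrow> \<bar>x i\<bar> \<le> r" and m: "\<And>i. i \<in> I \<Longrightarrow> m \<le> x i" "m > - 1"
  proof -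
    \<comment> \<open>The zero sum allows inserting \<open>x i\<close> for free. Each factor then
      carries \<open>r\<^sup>2 / (1 + m)\<close>, the worst case of the remainder in
      \<open>exp_le_add_one\<close>.\<close>
    have "exp (- (real (card I) * r\<^sup>2 / (1 + m))) = exp (\<Sum>i\<in>I. x i - r\<^sup>2 / (1 + m))"
      by (simp add: sum_subtractf sum)
    also have "\<dots> = (\<Prod>i\<in>I. exp (x i - r\<^sup>2 / (1 + m)))" by (rule exp_sum[OF fin])
    also have "\<dots> \<le> (\<Prod>i\<in>I. 1 + x i)"
    proof (intro prod_mono conjI)
      fix i assume i: "i \<in> I"
      have "(x i)\<^sup>2 \<le> r\<^sup>2" using power_mono[OF r[OF i], of 2] by simp
      then have "(x i)\<^sup>2 / (1 + x i) \<le> r\<^sup>2 / (1 + m)"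
        using m(1)[OF i] m(2) by (intro frac_le) auto
      then have "exp (x i - r\<^sup>2 / (1 + m)) \<le> exp (x i - (x i)\<^sup>2 / (1 + x i))" by simp
      also have "\<dots> \<le> 1 + x i" by (rule exp_le_add_one[OF gt[OF i]])
      finally show "exp (x i - r\<^sup>2 / (1 + m)) \<le> 1 + x i" .
    qed simp
    finally show ?thesis .
  qed
qed

section \<open>Trace, similarity and eigenvalues with multiplicity\<close>

lemma sum_list_diag_mat_comm:
  fixes A B :: "'a::comm_semiring_0 mat"
  assumes A: "A \<in> carrier_mat n m" and B: "B \<in> carrier_mat m n"
  shows "sum_list (diag_mat (A * B)) = sum_list (diag_mat (B * A))"
proof -
  have "sum_list (diag_mat (A * B)) = (\<Sum>i<n. \<Sum>j<m. A $$ (i,j) * B $$ (j,i))"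
    using A B by (simp add: diag_mat_def interv_sum_list_conv_sum_set_nat scalar_prod_def
        atLeast0LessThan)
  also have "\<dots> = (\<Sum>j<m. \<Sum>i<n. B $$ (j,i) * A $$ (i,j))"
    by (subst sum.swap) (simp add: mult.commute)
  also have "\<dots> = sum_list (diag_mat (B * A))"
    using A B by (simp add: diag_mat_def interv_sum_list_conv_sum_set_nat scalar_prod_def
        atLeast0LessThan)
  finally show ?thesis .
qed

lemma sum_list_diag_mat_similar:
  fixes A B :: "'a::comm_ring_1 mat"
  assumes "A \<in> carrier_mat n n" "similar_mat A B"
  shows "sum_list (diag_mat A) = sum_list (diag_mat B)"
proof -
  obtain S T where "similar_mat_wit A B S T" using assms(2) unfolding similar_mat_def by blast
  note wit = similar_mat_witD2[OF assms(1) this]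
  note B = wit(5) and S = wit(6) and T = wit(7)
  have "sum_list (diag_mat A) = sum_list (diag_mat (S * (B * T)))"
    using wit(3) assoc_mult_mat[OF S B T] by simp
  also have "\<dots> = sum_list (diag_mat (B * T * S))"
    by (rule sum_list_diag_mat_comm[OF S mult_carrier_mat[OF B T]])
  also have "B * T * S = B" using assoc_mult_mat[OF B T S] wit(2) right_mult_one_mat[OF B] by simp
  finally show ?thesis .
qed

text \<open>The matrices conjugating \<open>B\<close> to \<open>A\<close> also fix the identity,
  because \<open>S * T = 1\<^sub>m n\<close>.\<close>

lemma similar_mat_one_add:
  fixes A B :: "'a::comm_ring_1 mat"
  assumes "A \<in> carrier_mat n n" "similar_mat A B"
  shows "similar_mat (1\<^sub>m n + A) (1\<^sub>m n + B)"
proof -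
  obtain S T where "similar_mat_wit A B S T" using assms(2) unfolding similar_mat_def by blast
  note wit = similar_mat_witD2[OF assms(1) this]
  note B = wit(5) and S = wit(6) and T = wit(7)
  have "S * (1\<^sub>m n + B) * T = (S + S * B) * T"
    using mult_add_distrib_mat[OF S one_carrier_mat B] right_mult_one_mat[OF S] by simp
  also have "\<dots> = 1\<^sub>m n + A"
    using add_mult_distrib_mat[OF S mult_carrier_mat[OF S B] T] wit(1,3) by simp
  finally have "similar_mat_wit (1\<^sub>m n + A) (1\<^sub>m n + B) S T"
    using wit by (intro similar_mat_witI[of S T n]) simp_all
  then show ?thesis unfolding similar_mat_def by blast
qed

text \<open>The list is the diagonal of a Schur triangular form. Unlike the set
  \<open>spectrum A\<close> it records algebraic multiplicities, which the trace and the determinant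
  require.\<close>

lemma complex_eigenvalue_list:
  fixes A :: "complex mat"
  assumes A: "A \<in> carrier_mat n n"
  obtains es where "length es = n" "set es = spectrum A" "sum_list es = sum_list (diag_mat A)"
    "det (1\<^sub>m n + A) = prod_list (map (\<lambda>e. 1 + e) es)"
proof -
  obtain as where "char_poly A = (\<Prod>a\<leftarrow>as. [:- a, 1:])" using char_poly_factorized[OF A] by blast
  from schur_decomposition_exists[OF A this] obtain B where
    B: "B \<in> carrier_mat n n" "upper_triangular B" and sim: "similar_mat A B" by blast
  let ?es = "diag_mat B"
  have "set ?es = spectrum A"
    unfolding spectrum_root_char_poly[OF A] char_poly_similar[OF sim]
      char_poly_upper_triangular[OF B]
    by (auto simp: poly_prod_list prod_list_zero_iff)
  moreover have "det (1\<^sub>m n + A) = prod_list (map (\<lambda>e. 1 + e) ?es)"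
  proof -
    have "det (1\<^sub>m n + A) = det (1\<^sub>m n + B)" by (rule det_similar[OF similar_mat_one_add[OF A sim]])
    also have "\<dots> = prod_list (diag_mat (1\<^sub>m n + B))"
      using B by (intro det_upper_triangular[of _ n] upper_triangularI) (auto dest: upper_triangularD)
    also have "diag_mat (1\<^sub>m n + B) = map (\<lambda>e. 1 + e) ?es"
      using B by (auto simp: diag_mat_def)
    finally show ?thesis .
  qed
  moreover have "length ?es = n" using B by (simp add: diag_mat_def)
  ultimately show ?thesis using that sum_list_diag_mat_similar[OF A sim] by simp
qed

section \<open>Entries of the block diagonal part\<close>

fun block_index :: "nat list \<Rightarrow> nat \<Rightarrow> nat" where
  "block_index [] i = 0"
| "block_index (n # ns) i = (if i < n then 0 else Suc (block_index ns (i - n)))"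

text \<open>Equality of \<open>block_index\<close> replaces offset arithmetic: it says that
  \<open>(r, c)\<close> lies in a diagonal block. The function \<open>f\<close> gives entries in
  global coordinates; it is generalized in the induction because the remaining blocks see it shifted
  by the order of the first one.\<close>

lemma diag_block_mat_index:
  assumes "\<And>j. j < length Bs \<Longrightarrow> Bs ! j \<in> carrier_mat (ns ! j) (ns ! j)"
    and "length Bs = length ns"
    and "\<And>j r c. j < length ns \<Longrightarrow> r < ns ! j \<Longrightarrow> c < ns ! j \<Longrightarrow>
      Bs ! j $$ (r, c) = f (sum_list (take j ns) + r) (sum_list (take j ns) + c)"
  shows "diag_block_mat Bs \<in> carrier_mat (sum_list ns) (sum_list ns) \<and>
    (\<forall>r c. r < sum_list ns \<longrightarrow> c < sum_list ns \<longrightarrow>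
      diag_block_mat Bs $$ (r, c) = (if block_index ns r = block_index ns c then f r c else 0))"
  using assms
proof (induction ns arbitrary: Bs f)
  case Nil
  then show ?case by simp
next
  case (Cons n ns)
  obtain B Bs' where Bs: "Bs = B # Bs'" using Cons.prems(2) by (cases Bs) auto
  have B: "B \<in> carrier_mat n n" using Cons.prems(1)[of 0] Bs by simp
  have Bf: "B $$ (r, c) = f r c" if "r < n" "c < n" for r c
    using Cons.prems(3)[of 0 r c] Bs that by simp
  have "diag_block_mat Bs' \<in> carrier_mat (sum_list ns) (sum_list ns) \<and>
    (\<forall>r c. r < sum_list ns \<longrightarrow> c < sum_list ns \<longrightarrow> diag_block_mat Bs' $$ (r, c) =
      (if block_index ns r = block_index ns c then f (n + r) (n + c) else 0))"
  proof (rule Cons.IH)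
    show "Bs' ! j \<in> carrier_mat (ns ! j) (ns ! j)" if "j < length Bs'" for j
      using Cons.prems(1)[of "Suc j"] that Bs by simp
    show "length Bs' = length ns" using Cons.prems(2) Bs by simp
    show "Bs' ! j $$ (r, c) = f (n + (sum_list (take j ns) + r)) (n + (sum_list (take j ns) + c))"
      if "j < length ns" "r < ns ! j" "c < ns ! j" for j r c
      using Cons.prems(3)[of "Suc j" r c] that Bs by (simp add: add.assoc)
  qed
  then show ?case using B Bf unfolding Bs by (auto simp: Let_def)
qed

lemma
  shows block_diag_part_carrier: "block_diag_part ns A \<in> carrier_mat (sum_list ns) (sum_list ns)"
    and block_diag_part_index: "r < sum_list ns \<Longrightarrow> c < sum_list ns \<Longrightarrow>
      block_diag_part ns A $$ (r, c) = (if block_index ns r = block_index ns c then A $$ (r, c) else 0)"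
proof -
  have "block_diag_part ns A \<in> carrier_mat (sum_list ns) (sum_list ns) \<and>
    (\<forall>r c. r < sum_list ns \<longrightarrow> c < sum_list ns \<longrightarrow> block_diag_part ns A $$ (r, c) =
      (if block_index ns r = block_index ns c then A $$ (r, c) else 0))"
    unfolding block_diag_part_def by (rule diag_block_mat_index) (auto simp: block_def)
  then show "block_diag_part ns A \<in> carrier_mat (sum_list ns) (sum_list ns)"
    and "r < sum_list ns \<Longrightarrow> c < sum_list ns \<Longrightarrow>
      block_diag_part ns A $$ (r, c) = (if block_index ns r = block_index ns c then A $$ (r, c) else 0)"
    by blast+
qed

section \<open>Inverses of block diagonal matrices\<close>

lemma inv_mat_inverts:
  fixes A :: "'a::field mat"
  assumes A: "A \<in> carrier_mat n n" and inv: "invertible_mat A"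
  shows "A * inv_mat A = 1\<^sub>m n" "inv_mat A * A = 1\<^sub>m n" "inv_mat A \<in> carrier_mat n n"
proof -
  obtain B where B: "A * B = 1\<^sub>m n" "B * A = 1\<^sub>m (dim_row B)"
    using inv A unfolding invertible_mat_def inverts_mat_def by auto
  \<comment> \<open>The definition of \<open>invertible_mat\<close> does not fix the dimensions of
    \<open>B\<close>; comparing column counts in both equations does.\<close>
  from arg_cong[OF B(1), of dim_col] arg_cong[OF B(2), of dim_col] A
  have "B \<in> carrier_mat n n" by auto
  with A B have "A \<in> Units (ring_mat TYPE('a) n ())"
    unfolding Units_def ring_mat_def by auto
  with mat_inverse(1)[OF A, of "()"] obtain C where "mat_inverse A = Some C"
    by (cases "mat_inverse A") auto
  with mat_inverse(2)[OF A this]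
  show "A * inv_mat A = 1\<^sub>m n" "inv_mat A * A = 1\<^sub>m n" "inv_mat A \<in> carrier_mat n n"
    by (auto simp: inv_mat_def)
qed

text \<open>A matrix is block diagonal iff it commutes with the diagonal matrix \<open>T\<close> of block indices, and
  commuting with \<open>T\<close> passes to the inverse.\<close>

lemma inverse_block_diagonal:
  fixes D E :: "'a::field_char_0 mat" and b :: "nat \<Rightarrow> nat"
  assumes D: "D \<in> carrier_mat n n" and E: "E \<in> carrier_mat n n"
    and DE: "D * E = 1\<^sub>m n" and ED: "E * D = 1\<^sub>m n"
    and D0: "\<And>i j. i < n \<Longrightarrow> j < n \<Longrightarrow> b i \<noteq> b j \<Longrightarrow> D $$ (i, j) = 0"
    and ij: "i < n" "j < n" "b i \<noteq> b j"
  shows "E $$ (i, j) = 0"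
proof -
  define T :: "'a mat" where "T = mat n n (\<lambda>(i, j). if i = j then of_nat (b i) else 0)"
  have T: "T \<in> carrier_mat n n" by (simp add: T_def)
  have AT: "(A * T) $$ (i, j) = A $$ (i, j) * of_nat (b j)"
    if "A \<in> carrier_mat n n" "i < n" "j < n" for A i j
    using that by (simp add: T_def scalar_prod_def if_distrib[of "\<lambda>x. _ * x"] cong: if_cong)
  have TA: "(T * A) $$ (i, j) = of_nat (b i) * A $$ (i, j)"
    if "A \<in> carrier_mat n n" "i < n" "j < n" for A i j
    using that by (simp add: T_def scalar_prod_def if_distrib[of "\<lambda>x. x * _"] cong: if_cong)
  have "D * T = T * D"
  proof (rule eq_matI)
    fix i j assume "i < dim_row (T * D)" "j < dim_col (T * D)"
    then have "i < n" "j < n" using T D by auto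
    then show "(D * T) $$ (i, j) = (T * D) $$ (i, j)"
      using D0[of i j] by (cases "b i = b j") (simp_all add: AT[OF D] TA[OF D])
  qed (use T D in auto)
  then have "E * (D * T) * E = E * (T * D) * E" by simp
  moreover have "E * (D * T) * E = T * E"
    using assoc_mult_mat[OF E D T] ED left_mult_one_mat[OF T] by simp
  moreover have "E * (T * D) * E = E * T"
    using assoc_mult_mat[OF E T D] assoc_mult_mat[OF mult_carrier_mat[OF E T] D E] DE
      right_mult_one_mat[OF mult_carrier_mat[OF E T]] by simp
  ultimately have "(T * E) $$ (i, j) = (E * T) $$ (i, j)" by simp
  \<comment> \<open>The entries give
    \<open>of_nat (b i) * E $$ (i, j) = E $$ (i, j) * of_nat (b j)\<close>. In characteristic zero
    distinct indices have distinct images, so the entry vanishes.\<close>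
  then show ?thesis using ij by (simp add: AT[OF E] TA[OF E])
qed

text \<open>Strict positivity is tied to a nonzero spectral radius: if all eigenvalues of
  \<open>P\<close> vanish, for instance when \<open>M_off\<close> is zero, then
  \<open>det M = det M_D\<close> and \<open>q = 0\<close>.\<close>

theorem theorem2p1:
  fixes M :: "complex mat" and n k :: nat and ns :: "nat list"
  defines "M_D \<equiv> block_diag_part ns M"
    and "M_off \<equiv> block_off_part ns M"
  defines "P \<equiv> inv_mat M_D * M_off"
  defines "q \<equiv> (Re (det M_D) - Re (det M)) / Re (det M_D)"
  assumes "M \<in> carrier_mat n n" and "n \<ge> 1"
    and "length ns = k" and "\<forall>m\<in>set ns. m \<ge> 1" and "sum_list ns = n"
    and "det M \<in> \<real>"
    and "invertible_mat M_D" and "det M_D \<in> \<real>"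
    and "\<forall>l. eigenvalue P l \<longrightarrow> l \<in> \<real> \<and> Re l > -1"
  shows "0 \<le> q \<and> (spectral_radius P \<noteq> 0 \<longrightarrow> 0 < q) \<and>
    q \<le> 1 - exp (- (real n * (spectral_radius P)\<^sup>2 / (1 + min_eigenvalue P)))"
proof -
  note M = assms(5) and eig = assms(13)
  have D: "M_D \<in> carrier_mat n n"
    using block_diag_part_carrier[of ns M] assms(9) by (simp add: M_D_def)
  have D_index: "M_D $$ (i, j) = (if block_index ns i = block_index ns j then M $$ (i, j) else 0)"
    if "i < n" "j < n" for i j
    using block_diag_part_index[of i ns j M] that assms(9) by (simp add: M_D_def)
  have off_eq: "M_off = M - M_D" by (simp add: M_off_def M_D_def block_off_part_def)
  have off: "M_off \<in> carrier_mat n n" using M D by (simp add: off_eq minus_carrier_mat)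
  note inv = inv_mat_inverts[OF D assms(11)]
  have P: "P \<in> carrier_mat n n" using inv(3) off by (simp add: P_def)
  have "P $$ (i, i) = 0" if i: "i < n" for i
  proof -
    \<comment> \<open>One factor always vanishes: \<open>M_off\<close> inside a diagonal block, the
      inverse of \<open>M_D\<close> outside.\<close>
    have "inv_mat M_D $$ (i, j) * M_off $$ (j, i) = 0" if j: "j < n" for j
    proof (cases "block_index ns i = block_index ns j")
      case True
      then show ?thesis using i j M D by (simp add: off_eq D_index)
    next
      case False
      have "inv_mat M_D $$ (i, j) = 0"
        by (rule inverse_block_diagonal[OF D inv(3,1,2) _ i j False]) (simp add: D_index)
      then show ?thesis by simp
    qed
    then show ?thesis using i inv(3) off by (auto simp: P_def scalar_prod_def intro!: sum.neutral)
  qed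
  then have trace: "sum_list (diag_mat P) = 0"
    using P by (simp add: diag_mat_def interv_sum_list_conv_sum_set_nat)
  obtain es where es: "length es = n" "set es = spectrum P" "sum_list es = 0"
    and det_es: "det (1\<^sub>m n + P) = prod_list (map (\<lambda>e. 1 + e) es)"
    using complex_eigenvalue_list[OF P] trace by metis
  define x where "x i = Re (es ! i)" for i
  have eig_es: "es ! i \<in> \<real> \<and> Re (es ! i) > - 1" if "i < n" for i
    using eig es(1,2) that nth_mem[of i es] by (auto simp: spectrum_def)
  have es_x: "es ! i = of_real (x i)" if "i < n" for i
    using eig_es[OF that] by (simp add: x_def)
  have gt: "\<And>i. i \<in> {..<n} \<Longrightarrow> x i > - 1" using eig_es by (simp add: x_def)
  have sum: "(\<Sum>i<n. x i) = 0"
  proof -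
    have "Re (sum_list es) = (\<Sum>i<n. x i)"
      by (simp add: sum_list_sum_nth es(1) x_def atLeast0LessThan)
    then show ?thesis using es(3) by simp
  qed
  have "det (1\<^sub>m n + P) = (\<Prod>i<n. 1 + es ! i)"
    by (simp add: det_es prod.list_conv_set_nth es(1) atLeast0LessThan)
  also have "\<dots> = of_real (\<Prod>i<n. 1 + x i)" by (simp add: es_x)
  finally have det_P: "det (1\<^sub>m n + P) = of_real (\<Prod>i<n. 1 + x i)" .
  have "M = M_D * (1\<^sub>m n + P)"
  proof -
    have "M_D * (1\<^sub>m n + P) = M_D + M_D * inv_mat M_D * M_off"
      using mult_add_distrib_mat[OF D one_carrier_mat P] right_mult_one_mat[OF D]
        assoc_mult_mat[OF D inv(3) off] by (simp add: P_def)
    also have "\<dots> = M_D + (M - M_D)" using inv(1) left_mult_one_mat[OF off] by (simp add: off_eq)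
    also have "\<dots> = M" using M D by auto
    finally show ?thesis by simp
  qed
  then have "det M = det M_D * of_real (\<Prod>i<n. 1 + x i)"
    using det_mult[OF D, of "1\<^sub>m n + P"] P det_P by simp
  then have Re_det: "Re (det M) = Re (det M_D) * (\<Prod>i<n. 1 + x i)"
    by (simp only: times_complex.sel Re_complex_of_real Im_complex_of_real mult_zero_right diff_zero)
  \<comment> \<open>The denominator of \<open>q\<close> is nonzero: \<open>det M_D\<close> is
    nonzero and real, hence so is its real part.\<close>
  have "det M_D * det (inv_mat M_D) = 1" using det_mult[OF D inv(3)] inv(1) by simp
  then have "det M_D \<noteq> 0" by auto
  then have "Re (det M_D) \<noteq> 0" using assms(12) by (auto simp: complex_is_Real_iff complex_eq_iff)
  then have q: "q = 1 - (\<Prod>i<n. 1 + x i)" by (simp add: q_def Re_det field_simps)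
  have n0: "n > 0" using assms(6) by simp
  have mem: "es ! i \<in> spectrum P" if "i < n" for i
    using nth_mem[of i es] that unfolding es(1,2) .
  have fin: "finite (spectrum P)" by (rule card_finite_spectrum(1)[OF P])
  \<comment> \<open>Nonemptiness makes \<open>Min\<close> an attained value, so
    \<open>min_eigenvalue P\<close> inherits the bound \<open>> - 1\<close> from an actual
    eigenvalue.\<close>
  have "spectrum P \<noteq> {}" using mem[OF n0] by auto
  then have "min_eigenvalue P \<in> Re ` spectrum P"
    unfolding min_eigenvalue_def using fin by (intro Min_in) auto
  then have min_gt: "min_eigenvalue P > - 1" using eig by (auto simp: spectrum_def)
  have min_le: "\<And>i. i \<in> {..<n} \<Longrightarrow> min_eigenvalue P \<le> x i"
    unfolding min_eigenvalue_def x_def using fin mem by (intro Min_le) auto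
  have rad: "\<And>i. i \<in> {..<n} \<Longrightarrow> \<bar>x i\<bar> \<le> spectral_radius P"
    using spectral_radius_mem_max(2)[OF P n0] mem es_x by (metis imageI lessThan_iff norm_of_real)
  have "(\<Prod>i<n. 1 + x i) < 1" if "spectral_radius P \<noteq> 0"
  proof -
    \<comment> \<open>An eigenvalue attaining the spectral radius is nonzero here and supplies the
      strict factor.\<close>
    obtain i where i: "i < n" "spectral_radius P = norm (es ! i)"
      using spectral_radius_mem_max(1)[OF P n0] es(1,2) by (metis imageE in_set_conv_nth)
    then have "x i \<noteq> 0" using that by (simp add: es_x)
    then show ?thesis using i(1) by (intro prod_add_one_less[of _ _ i, OF _ sum gt]) auto
  qed
  moreover have "(\<Prod>i<n. 1 + x i) \<le> 1" by (rule prod_add_one_le[OF _ sum gt]) auto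
  moreover have "exp (- (real n * (spectral_radius P)\<^sup>2 / (1 + min_eigenvalue P))) \<le> (\<Prod>i<n. 1 + x i)"
    using prod_add_one_ge[OF _ sum gt rad min_le min_gt] by simp
  ultimately show ?thesis unfolding q by auto
qed

end
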